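(* Let $x\in\mathbb{R}^m$ with $x\neq\vec 0$. Consider the conditions: (D1) the vector $\vec 0\in\mathbb{R}^m$ is attainable by Player 1 (in the game based on $G$); (D2) there is $\delta>0$ such that the vector $\vec 0\in\mathbb{R}^m$ is attainable by Player 1 in the game based on $(G-\delta x)$; (D3) there is $\delta>0$ such that $v_\lambda\ge\delta\langle x,\lambda\rangle$ for every $\lambda\in\mathbb{R}^m$; (D4) there is $\delta_0>0$ such that for every $q\in\Delta(A_2)$ there are $p\in\Delta(A_1)$ and $\delta>\delta_0$ satisfying $u(p,q)=\delta x$. Then, for each $j\in\{2,3,4\}$, the vector $x$ is attainable by Player 1 (in the game based on $G$) if and only if both (D1) and (D$j$) hold.
   Context: **Game.** $A_1,A_2$ are finite nonempty action sets of Players 1 and 2, $m\ge 1$ is an integer, and $u:A_1\times A_2\to[-1,1]^m$ is a vector payoff function, extended bilinearly to $\Delta(A_1)\times\Delta(A_2)$, where $\Delta(A_i)$ is the set of mixed actions (probability distributions on $A_i$). $G=(A_1,A_2,u)$ is the one-shot game. The continuous-time game $\Gamma$ based on $G$ is played over $[0,\infty)$. **Strategies.** Let $\mathcal{C}_i$ be the set of controls of player $i$, i.e. measurable functions $a_i:[0,\infty)\to\Delta(A_i)$; $-i$ denotes the opponent of $i$. A strategy of player $i$ is a function $\sigma_i:\mathcal{C}_{-i}\to\mathcal{C}_i$ for which there is a strictly increasing sequence $0=\tau_i^0<\tau_i^1<\tau_i^2<\cdots$ of real numbers with $\tau_i^k\to\infty$ such that for all $a_{-i},a'_{-i}\in\mathcal{C}_{-i}$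 and all $k\ge 0$: if $a_{-i}(t)=a'_{-i}(t)$ for all $t\in[0,\tau_i^k)$, then $(\sigma_i(a_{-i}))(t)=(\sigma_i(a'_{-i}))(t)$ for all $t\in[\tau_i^k,\tau_i^{k+1})$. A pair of strategies $\sigma=(\sigma_1,\sigma_2)$ determines a unique play path $a^\sigma=(a_1,a_2)\in\mathcal{C}_1\times\mathcal{C}_2$ with $\sigma_1(a_2)=a_1$ and $\sigma_2(a_1)=a_2$. **Payoffs.** The cumulative payoff up to time $t$ is $\gamma^t(\sigma)=\int_0^t u(a^\sigma(s))\,ds\in\mathbb{R}^m$. **Distance.** $\|\cdot\|$ is the Euclidean norm and $d(x,A)=\inf_{y\in A}\|x-y\|$. **Attainability.** A nonempty closed set $Y\subseteq\mathbb{R}^m$ is attainable by Player 1 if there is $T>0$ such that for every $\varepsilon>0$ there is a strategy $\sigma_1$ of Player 1 with $d(\gamma^t(\sigma_1,\sigma_2),Y)\le\varepsilon$ for all $t\ge T$ and all strategies $\sigma_2$ of Player 2. A vector $x$ is attainable by Player 1 if $\{x\}$ is. **Shifted game.** For $y\in\mathbb{R}^m$, $(G-y)$ is the one-shot game with the same players and action sets as $G$ and payoff function $(u-y)(a_1,a_2)=u(a_1,a_2)-y$; the continuous-time game based on it, and attainability in it, are defined in the same way with $u-y$ in place of $u$ (its payoffs need not lie in $[-1,1]^m$). **Projected games.** For $\lambda\in\mathbb{R}^m$, $v_\lambda$ is the value of the zero-sum one-shot game with action sets $A_1,A_2$ in which Player 2 pays Player 1 the amount $\langle\lambda,u(a_1,a_2)\rangle$;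 i.e. $v_\lambda=\max_{p\in\Delta(A_1)}\min_{q\in\Delta(A_2)}\langle\lambda,u(p,q)\rangle$. *)

theory Defs
  imports "HOL-Analysis.Analysis"
begin

definition mixed :: "(real ^ 'n::finite) set" where
  "mixed = {p. (\<forall>i. 0 \<le> p $ i) \<and> (\<Sum>i\<in>UNIV. p $ i) = 1}"

definition mixed_payoff ::
  "('a::finite \<Rightarrow> 'b::finite \<Rightarrow> real ^ 'm::finite) \<Rightarrow> real ^ 'a \<Rightarrow> real ^ 'b \<Rightarrow> real ^ 'm" where
  "mixed_payoff u p q = (\<Sum>a\<in>UNIV. \<Sum>b\<in>UNIV. (p $ a * q $ b) *\<^sub>R u a b)"

text \<open>Controls are functions on \<open>[0,\<infinity>)\<close>: the extensional function space makes two of them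
  equal iff they agree at all nonnegative times. Measurability is Lebesgue measurability.\<close>

definition controls :: "(real \<Rightarrow> real ^ 'n::finite) set" where
  "controls = {a \<in> {0..} \<rightarrow>\<^sub>E mixed. a \<in> borel_measurable (lebesgue_on {0..})}"

text \<open>\<open>'o\<close> indexes the actions of the opponent, \<open>'n\<close> those of the player using the strategy.\<close>

definition strategies ::
  "((real \<Rightarrow> real ^ 'o::finite) \<Rightarrow> (real \<Rightarrow> real ^ 'n::finite)) set" where
  "strategies = {\<sigma> \<in> controls \<rightarrow> controls.
     \<exists>\<tau> :: nat \<Rightarrow> real. \<tau> 0 = 0 \<and> strict_mono \<tau> \<and> filterlim \<tau> at_top sequentially \<and>
       (\<forall>a\<in>controls. \<forall>a'\<in>controls. \<forall>k.
          (\<forall>t\<in>{0..<\<tau> k}. a t = a' t) \<longrightarrow> (\<forall>t\<in>{\<tau> k..<\<tau> (Suc k)}. \<sigma> a t = \<sigma> a' t))}"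

definition play_path ::
  "((real \<Rightarrow> real ^ 'b::finite) \<Rightarrow> (real \<Rightarrow> real ^ 'a::finite)) \<Rightarrow>
   ((real \<Rightarrow> real ^ 'a) \<Rightarrow> (real \<Rightarrow> real ^ 'b)) \<Rightarrow>
   (real \<Rightarrow> real ^ 'a) \<times> (real \<Rightarrow> real ^ 'b)" where
  "play_path \<sigma>1 \<sigma>2 =
     (THE (a1, a2). a1 \<in> controls \<and> a2 \<in> controls \<and> \<sigma>1 a2 = a1 \<and> \<sigma>2 a1 = a2)"

definition cumulative_payoff ::
  "('a::finite \<Rightarrow> 'b::finite \<Rightarrow> real ^ 'm::finite) \<Rightarrow>
   ((real \<Rightarrow> real ^ 'b) \<Rightarrow> (real \<Rightarrow> real ^ 'a)) \<Rightarrow>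
   ((real \<Rightarrow> real ^ 'a) \<Rightarrow> (real \<Rightarrow> real ^ 'b)) \<Rightarrow> real \<Rightarrow> real ^ 'm" where
  "cumulative_payoff u \<sigma>1 \<sigma>2 t =
     (case play_path \<sigma>1 \<sigma>2 of (a1, a2) \<Rightarrow>
        LINT s:{0..t}|lebesgue. mixed_payoff u (a1 s) (a2 s))"

definition attainable_set ::
  "('a::finite \<Rightarrow> 'b::finite \<Rightarrow> real ^ 'm::finite) \<Rightarrow> (real ^ 'm) set \<Rightarrow> bool" where
  "attainable_set u Y \<longleftrightarrow> Y \<noteq> {} \<and> closed Y \<and>
     (\<exists>T>0. \<forall>\<epsilon>>0. \<exists>\<sigma>1\<in>strategies. \<forall>t\<ge>T. \<forall>\<sigma>2\<in>strategies.
        infdist (cumulative_payoff u \<sigma>1 \<sigma>2 t) Y \<le> \<epsilon>)"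

definition attainable ::
  "('a::finite \<Rightarrow> 'b::finite \<Rightarrow> real ^ 'm::finite) \<Rightarrow> real ^ 'm \<Rightarrow> bool" where
  "attainable u x \<longleftrightarrow> attainable_set u {x}"

definition shifted_game ::
  "('a::finite \<Rightarrow> 'b::finite \<Rightarrow> real ^ 'm::finite) \<Rightarrow> real ^ 'm \<Rightarrow> 'a \<Rightarrow> 'b \<Rightarrow> real ^ 'm" where
  "shifted_game u y = (\<lambda>a b. u a b - y)"

text \<open>By compactness and continuity the supremum and infimum are attained, so this is the
  max-min value.\<close>

definition projected_value ::
  "('a::finite \<Rightarrow> 'b::finite \<Rightarrow> real ^ 'm::finite) \<Rightarrow> real ^ 'm \<Rightarrow> real" where
  "projected_value u l = (SUP p\<in>mixed. INF q\<in>mixed. l \<bullet> mixed_payoff u p q)"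

end

theory Submission
  imports Defs
begin

text \<open>
  Everything reduces to one static condition. Call a vector \<open>c\<close> achievable if against every mixed
  action \<open>q\<close> of Player 2, known in advance, Player 1 has an answer \<open>p\<close> with payoff exactly \<open>c\<close>.
  Then \<open>x\<close> is attainable if and only if \<open>0\<close> is achievable and some \<open>\<delta> x\<close> with \<open>\<delta> > 0\<close> is
  (\<open>attainable_iff_achievable\<close>), and each of the conditions \<open>D2\<close>, \<open>D3\<close>, \<open>D4\<close> says, in the
  presence of \<open>D1\<close>, that some \<open>\<delta> x\<close> is achievable.

  Necessity: let Player 2 play \<open>q\<close> for ever. The cumulative payoff is close to \<open>x\<close> at all times from
  \<open>T\<close> on. The average of Player 1's control over \<open>[0,T]\<close> therefore yields a payoff close to \<open>x/T\<close>
  against \<open>q\<close>, and its average over \<open>[T,T+1]\<close> yields one close to \<open>0\<close>. Letting the error tend to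
  \<open>0\<close>, compactness gives exact answers. This uses that \<open>T\<close> does not depend on the error.

  Sufficiency: let the target move from \<open>0\<close> to \<open>x\<close> at constant speed during \<open>[0,T]\<close>, where
  \<open>T = 1/\<delta>\<close>, and rest at \<open>x\<close> afterwards. Over any time interval its mean velocity is a convex
  combination of \<open>\<delta> x\<close> and \<open>0\<close>, hence achievable. Player 1 tracks the target by Blackwell's
  approachability argument (\<open>tracking_strategy\<close>). On each block of time he plays a fixed mixed
  action for which, whatever Player 2 does, the deviation from the target is not pushed outwards; a
  separating hyperplane argument provides it (\<open>achievable_minimax\<close>). The squared deviation then
  grows by at most a constant times the squared block length, so blocks of length \<open>r/(k+1)\<close> cover
  the time axis while the deviation stays of order \<open>r\<close> for ever.

  Payoffs in the continuous-time game are defined through the play path of two strategies. Its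
  existence and uniqueness come from ranking the times by the number of grid points of both players
  up to then: what is played at time \<open>t\<close> depends on strictly lower ranks only
  (\<open>play_path_exists\<close>, \<open>play_path_unique\<close>).
\<close>

section \<open>Mixed actions and achievable vectors\<close>

definition achievable ::
  "('a::finite \<Rightarrow> 'b::finite \<Rightarrow> real ^ 'm::finite) \<Rightarrow> real ^ 'm \<Rightarrow> bool" where
  "achievable u c \<longleftrightarrow> (\<forall>q\<in>mixed. \<exists>p\<in>mixed. mixed_payoff u p q = c)"

lemma mixed_pure: "(axis i 1 :: real ^ 'n::finite) \<in> mixed"
  by (auto simp: mixed_def axis_def)

lemma mixed_nonempty: "(mixed :: (real ^ 'n::finite) set) \<noteq> {}"
  using mixed_pure by blast

lemma convex_mixed: "convex (mixed :: (real ^ 'n::finite) set)"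
  by (auto simp: convex_def mixed_def sum.distrib simp flip: sum_distrib_left)

lemma norm_mixed_le: "p \<in> mixed \<Longrightarrow> norm p \<le> 1"
  using norm_le_l1_cart[of p] by (simp add: mixed_def)

lemma compact_mixed: "compact (mixed :: (real ^ 'n::finite) set)"
proof -
  have "bounded (mixed :: (real ^ 'n) set)"
    using norm_mixed_le by (auto simp: bounded_iff)
  moreover have "closed (mixed :: (real ^ 'n) set)"
    unfolding mixed_def
    by (intro closed_Collect_conj closed_Collect_all closed_Collect_le closed_Collect_eq
        continuous_intros)
  ultimately show ?thesis by (simp add: compact_eq_bounded_closed)
qed

lemma bounded_bilinear_mixed_payoff: "bounded_bilinear (mixed_payoff u)"
proof -
  have "bilinear (mixed_payoff u)"
    unfolding bilinear_def mixed_payoff_def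
    by (auto intro!: linearI simp: algebra_simps sum.distrib scaleR_sum_right)
  then show ?thesis by (simp add: bilinear_conv_bounded_bilinear)
qed

lemma mixed_payoff_pure_right: "mixed_payoff u p (axis b 1) = (\<Sum>a\<in>UNIV. p $ a *\<^sub>R u a b)"
  by (simp add: mixed_payoff_def axis_def if_distrib[of "\<lambda>z. (_ * z) *\<^sub>R _"] cong: if_cong)

lemma mixed_payoff_expand_right:
  "mixed_payoff u p q = (\<Sum>b\<in>UNIV. q $ b *\<^sub>R mixed_payoff u p (axis b 1))"
  unfolding mixed_payoff_pure_right unfolding mixed_payoff_def scaleR_sum_right
  by (subst sum.swap) (simp add: mult.commute)

lemma mixed_payoff_shifted_game:
  assumes "p \<in> mixed" "q \<in> mixed"
  shows "mixed_payoff (shifted_game u y) p q = mixed_payoff u p q - y"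
proof -
  have "(\<Sum>a\<in>UNIV. \<Sum>b\<in>UNIV. (p $ a * q $ b) *\<^sub>R y) = y"
    using assms by (simp add: mixed_def flip: sum_distrib_left scaleR_sum_left)
  then show ?thesis
    by (simp add: mixed_payoff_def shifted_game_def scaleR_diff_right sum_subtractf)
qed

lemma achievable_shifted_game:
  "achievable (shifted_game u y) c \<longleftrightarrow> achievable u (c + y)"
  unfolding achievable_def
  by (metis (no_types, lifting) mixed_payoff_shifted_game diff_eq_eq)

lemma bounded_mixed_payoff:
  obtains K where "K > 0" "\<And>p q. p \<in> mixed \<Longrightarrow> q \<in> mixed \<Longrightarrow> norm (mixed_payoff u p q) \<le> K"
proof -
  obtain K where K: "K > 0" "\<And>p q. norm (mixed_payoff u p q) \<le> norm p * norm q * K"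
    using bounded_bilinear.pos_bounded[OF bounded_bilinear_mixed_payoff] by blast
  have "norm (mixed_payoff u p q) \<le> K" if "p \<in> mixed" "q \<in> mixed" for p q
  proof -
    have "norm p * norm q \<le> 1" using that by (simp add: mult_le_one norm_mixed_le)
    then show ?thesis
      using K(2)[of p q] K(1) mult_right_mono[of "norm p * norm q" 1 K] by linarith
  qed
  with K(1) show ?thesis using that by blast
qed

lemma image_mixed_payoff:
  shows compact_payoffs: "compact ((\<lambda>p. mixed_payoff u p q) ` mixed)"
    and convex_payoffs: "convex ((\<lambda>p. mixed_payoff u p q) ` mixed)"
proof -
  have L: "bounded_linear (\<lambda>p. mixed_payoff u p q)"
    by (rule bounded_bilinear.bounded_linear_left[OF bounded_bilinear_mixed_payoff])
  show "compact ((\<lambda>p. mixed_payoff u p q) ` mixed)"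
    by (intro compact_continuous_image compact_mixed linear_continuous_on L)
  show "convex ((\<lambda>p. mixed_payoff u p q) ` mixed)"
    by (intro convex_linear_image convex_mixed bounded_linear.linear L)
qed

text \<open>
  The payoffs that Player 1 can reach against a fixed \<open>q\<close> form a compact set, so approximate
  answers with arbitrarily small error yield an exact one.
\<close>

lemma achievable_approx:
  fixes u :: "'a::finite \<Rightarrow> 'b::finite \<Rightarrow> real ^ 'm::finite"
  assumes "\<And>q e. q \<in> mixed \<Longrightarrow> e > 0 \<Longrightarrow> \<exists>p\<in>mixed. norm (mixed_payoff u p q - c) < e"
  shows "achievable u c"
  unfolding achievable_def
proof
  fix q :: "real^'b" assume q: "q \<in> mixed"
  let ?S = "(\<lambda>p. mixed_payoff u p q) ` mixed"
  have "closed ?S" by (rule compact_imp_closed[OF compact_payoffs])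
  moreover have "\<forall>e>0. \<exists>y\<in>?S. dist y c < e" using assms[OF q] by (auto simp: dist_norm)
  ultimately have "c \<in> ?S" using closed_approachable by blast
  then show "\<exists>p\<in>mixed. mixed_payoff u p q = c" by auto
qed

lemma achievable_convex:
  fixes u :: "'a::finite \<Rightarrow> 'b::finite \<Rightarrow> real ^ 'm::finite"
  assumes "achievable u c" "achievable u d" "0 \<le> s" "0 \<le> t" "s + t = 1"
  shows "achievable u (s *\<^sub>R c + t *\<^sub>R d)"
  unfolding achievable_def
proof
  fix q :: "real^'b" assume q: "q \<in> mixed"
  then have "c \<in> (\<lambda>p. mixed_payoff u p q) ` mixed" "d \<in> (\<lambda>p. mixed_payoff u p q) ` mixed"
    using assms(1,2) unfolding achievable_def by (metis imageI)+
  from convexD[OF convex_payoffs this assms(3-5)]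
  show "\<exists>p\<in>mixed. mixed_payoff u p q = s *\<^sub>R c + t *\<^sub>R d" by auto
qed

text \<open>
  The minimax theorem, in the form that Blackwell's argument needs: answers to each single \<open>q\<close> can
  be exchanged for one \<open>p\<close> that works in direction \<open>l\<close> against all \<open>q\<close> at once. Record for every
  \<open>p\<close> the vector of directional excesses \<open>l \<bullet> (u(p,b) - c)\<close> over the pure actions \<open>b\<close>. If none of
  these vectors were in the nonpositive orthant, a hyperplane would separate them from it; its
  normal, rescaled, is a mixed action \<open>q\<close> against which no \<open>p\<close> brings the excess down to \<open>0\<close>,
  although by assumption some \<open>p\<close> has payoff exactly \<open>c\<close>.
\<close>

lemma achievable_minimax:
  fixes u :: "'a::finite \<Rightarrow> 'b::finite \<Rightarrow> real ^ 'm::finite"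
  assumes "achievable u c"
  shows "\<exists>p\<in>mixed. \<forall>q\<in>mixed. l \<bullet> (mixed_payoff u p q - c) \<le> 0"
proof -
  define w :: "real^'a \<Rightarrow> real^'b"
    where "w p = (\<chi> b. l \<bullet> (mixed_payoff u p (axis b 1) - c))" for p
  have w_inner: "q \<bullet> w p = l \<bullet> (mixed_payoff u p q - (\<Sum>b\<in>UNIV. q $ b) *\<^sub>R c)" for p q
  proof -
    have "q \<bullet> w p = (\<Sum>b\<in>UNIV. q $ b * w p $ b)" by (simp add: inner_vec_def)
    also have "\<dots> = l \<bullet> (\<Sum>b\<in>UNIV. q $ b *\<^sub>R mixed_payoff u p (axis b 1)) - (\<Sum>b\<in>UNIV. q $ b) * (l \<bullet> c)"
      by (simp add: w_def inner_diff_right inner_sum_right sum_subtractf sum_distrib_right right_diff_distrib)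
    finally show ?thesis
      by (simp add: inner_diff_right flip: mixed_payoff_expand_right)
  qed
  define N :: "(real^'b) set" where "N = {z. \<forall>b. z $ b \<le> 0}"
  have "w ` mixed \<inter> N \<noteq> {}"
  proof
    assume disj: "w ` mixed \<inter> N = {}"
    interpret B: bounded_bilinear "mixed_payoff u" by (rule bounded_bilinear_mixed_payoff)
    have cont: "continuous_on mixed w"
      unfolding w_def
      by (intro continuous_intros linear_continuous_on B.bounded_linear_left)
    have conv: "convex (w ` mixed)"
    proof (rule convexI, safe)
      fix p p' :: "real^'a" and s t :: real
      assume A: "p \<in> mixed" "p' \<in> mixed" "0 \<le> s" "0 \<le> t" "s + t = 1"
      have c: "c = s *\<^sub>R c + t *\<^sub>R c" using A(5) by (metis scaleR_left.add scaleR_one)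
      have "s *\<^sub>R w p + t *\<^sub>R w p' = w (s *\<^sub>R p + t *\<^sub>R p')"
        unfolding w_def
        by (subst (3) c, simp add: vec_eq_iff B.add_left B.scaleR_left inner_add_right inner_diff_right
            inner_scaleR_right algebra_simps)
      then show "s *\<^sub>R w p + t *\<^sub>R w p' \<in> w ` mixed"
        using convexD[OF convex_mixed A] by simp
    qed
    have "convex N" unfolding N_def
      by (auto simp: convex_def intro!: add_nonpos_nonpos mult_nonneg_nonpos)
    moreover have "closed N" unfolding N_def
      by (intro closed_Collect_all closed_Collect_le continuous_intros)
    ultimately obtain a \<beta> where a: "\<And>z. z \<in> w ` mixed \<Longrightarrow> a \<bullet> z < \<beta>" "\<And>z. z \<in> N \<Longrightarrow> a \<bullet> z > \<beta>"
      using separating_hyperplane_compact_closed[OF conv _ _ _ _ disj]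
        compact_continuous_image[OF cont compact_mixed] mixed_nonempty by blast
    have \<beta>: "\<beta> < 0" using a(2)[of 0] by (simp add: N_def)
    have le: "a $ b \<le> 0" for b
    proof (rule ccontr)
      assume "\<not> a $ b \<le> 0"
      then have "a $ b > 0" by simp
      \<comment> \<open>this point of the orthant would lie on the separating hyperplane\<close>
      define z where "z = axis b (\<beta> / a $ b)"
      have "z \<in> N" using \<open>a $ b > 0\<close> \<beta> by (auto simp: z_def N_def axis_def divide_nonpos_pos)
      moreover have "a \<bullet> z = \<beta>" using \<open>a $ b > 0\<close> by (simp add: z_def inner_axis)
      ultimately show False using a(2) by force
    qed
    define s where "s = (\<Sum>b\<in>UNIV. a $ b)"
    have "s \<noteq> 0"
    proof
      assume "s = 0"
      then have "(\<Sum>b\<in>UNIV. - (a $ b)) = 0" by (simp add: s_def sum_negf)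
      then have "\<forall>b. a $ b = 0" using le by (subst (asm) sum_nonneg_eq_0_iff) auto
      then have "a = 0" by (simp add: vec_eq_iff)
      moreover obtain p :: "real^'a" where "p \<in> mixed" using mixed_nonempty by blast
      ultimately show False using a(1)[of "w p"] \<beta> by simp
    qed
    then have s: "s < 0" using le sum_nonpos[of UNIV "\<lambda>b. a $ b"] by (force simp: s_def)
    define q where "q = (1 / s) *\<^sub>R a"
    have "q \<in> mixed" using s le
      by (auto simp: q_def mixed_def divide_nonpos_neg s_def simp flip: sum_divide_distrib)
    then obtain p where p: "p \<in> mixed" "mixed_payoff u p q = c"
      using assms unfolding achievable_def by blast
    have "q \<bullet> w p = 0"
      unfolding w_inner using p \<open>q \<in> mixed\<close> by (simp add: mixed_def)
    then have "a \<bullet> w p = 0" using s by (simp add: q_def)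
    then show False using a(1)[of "w p"] p \<beta> by simp
  qed
  then obtain p where p: "p \<in> mixed" "\<And>b. w p $ b \<le> 0" unfolding N_def by auto
  have "l \<bullet> (mixed_payoff u p q - c) \<le> 0" if "q \<in> mixed" for q
  proof -
    have "q \<bullet> w p \<le> 0" unfolding inner_vec_def using that p(2)
      by (auto simp: mixed_def intro!: sum_nonpos mult_nonneg_nonpos)
    then show ?thesis unfolding w_inner using that by (simp add: mixed_def)
  qed
  with p(1) show ?thesis by blast
qed

text \<open>
  Achievability in dual form, as \<open>D3\<close> states it. If \<open>c\<close> is achievable, a minimax answer in direction \<open>- l\<close> secures
  \<open>l \<bullet> c\<close> in the projected game. Conversely, if \<open>c\<close> lies outside the compact convex set of payoffs
  against some \<open>q\<close>, the direction that separates it from this set has a value smaller than \<open>l \<bullet> c\<close>.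
\<close>

lemma projected_value_ge_iff_achievable:
  fixes u :: "'a::finite \<Rightarrow> 'b::finite \<Rightarrow> real ^ 'm::finite"
  shows "(\<forall>l. projected_value u l \<ge> l \<bullet> c) \<longleftrightarrow> achievable u c"
proof
  obtain K where K: "K > 0"
    "\<And>p q. p \<in> mixed \<Longrightarrow> q \<in> mixed \<Longrightarrow> norm (mixed_payoff u p q) \<le> K"
    using bounded_mixed_payoff by blast
  have bnd: "\<bar>l \<bullet> mixed_payoff u p q\<bar> \<le> norm l * K" if "p \<in> mixed" "q \<in> mixed" for l p q
    using Cauchy_Schwarz_ineq2[of l "mixed_payoff u p q"] K(2)[OF that]
    by (meson mult_left_mono norm_ge_zero order_trans)
  have below: "bdd_below ((\<lambda>q. l \<bullet> mixed_payoff u p q) ` mixed)" if "p \<in> mixed" for l p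
    using bnd[OF that, of _ l] by (intro bdd_belowI2[of _ "- (norm l * K)"]) (simp add: abs_le_iff minus_le_iff)
  have INF_le: "(INF q\<in>mixed. l \<bullet> mixed_payoff u p q) \<le> l \<bullet> mixed_payoff u p q"
    if "p \<in> mixed" "q \<in> mixed" for l p q
    by (rule cINF_lower[OF below[OF that(1)] that(2)])
  {
    assume ach: "achievable u c"
    show "\<forall>l. projected_value u l \<ge> l \<bullet> c"
    proof
      fix l
      obtain p where p: "p \<in> mixed" "\<And>q. q \<in> mixed \<Longrightarrow> (- l) \<bullet> (mixed_payoff u p q - c) \<le> 0"
        using achievable_minimax[OF ach] by blast
      obtain q0 :: "real^'b" where q0: "q0 \<in> mixed" using mixed_nonempty by blast
      have "l \<bullet> c \<le> (INF q\<in>mixed. l \<bullet> mixed_payoff u p q)"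
        using p(2) by (intro cINF_greatest mixed_nonempty) (simp add: inner_diff_right)
      also have "\<dots> \<le> projected_value u l"
        unfolding projected_value_def
      proof (rule cSUP_upper[OF p(1)], rule bdd_aboveI2)
        fix p' :: "real^'a" assume "p' \<in> mixed"
        then show "(INF q\<in>mixed. l \<bullet> mixed_payoff u p' q) \<le> norm l * K"
          using INF_le[of p' q0 l] bnd[of p' q0 l] q0 by linarith
      qed
      finally show "projected_value u l \<ge> l \<bullet> c" .
    qed
  next
    assume val: "\<forall>l. projected_value u l \<ge> l \<bullet> c"
    show "achievable u c"
      unfolding achievable_def
    proof (rule ccontr)
      assume "\<not> (\<forall>q\<in>mixed. \<exists>p\<in>mixed. mixed_payoff u p q = c)"
      then obtain q where q: "q \<in> mixed" "c \<notin> (\<lambda>p. mixed_payoff u p q) ` mixed" by auto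
      obtain a \<beta> where a: "a \<bullet> c < \<beta>" "\<And>p. p \<in> mixed \<Longrightarrow> a \<bullet> mixed_payoff u p q > \<beta>"
        using separating_hyperplane_closed_point[OF convex_payoffs
            compact_imp_closed[OF compact_payoffs] q(2)] by blast
      have "projected_value u (- a) \<le> - \<beta>"
        unfolding projected_value_def
      proof (rule cSUP_least[OF mixed_nonempty])
        fix p :: "real^'a" assume p: "p \<in> mixed"
        show "(INF q\<in>mixed. (- a) \<bullet> mixed_payoff u p q) \<le> - \<beta>"
          using INF_le[OF p q(1), of "- a"] a(2)[OF p] by simp
      qed
      with val[rule_format, of "- a"] a(1) show False by simp
    qed
  }
qed

section \<open>Time grids\<close>

text \<open>
  For a grid \<open>0 = \<tau> 0 < \<tau> 1 < \<dots>\<close> that tends to infinity, this is the index \<open>k\<close> of the block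
  \<open>[\<tau> k, \<tau> (k+1))\<close> that contains \<open>t \<ge> 0\<close>. As the least number with a
  measurable property it is a measurable function of \<open>t\<close>.
\<close>

definition block :: "(nat \<Rightarrow> real) \<Rightarrow> real \<Rightarrow> nat" where
  "block \<tau> t = (LEAST k. t < \<tau> (Suc k))"

lemma block_upper:
  assumes "filterlim \<tau> at_top sequentially"
  shows "t < \<tau> (Suc (block \<tau> t))"
proof -
  have "\<forall>\<^sub>F k in sequentially. t < \<tau> k"
    using assms unfolding filterlim_at_top_dense by blast
  then obtain n where "\<And>k. k \<ge> n \<Longrightarrow> t < \<tau> k" unfolding eventually_sequentially by blast
  then have "t < \<tau> (Suc n)" by simp
  then have "\<exists>k. t < \<tau> (Suc k)" ..
  then show ?thesis unfolding block_def by (rule LeastI_ex[of "\<lambda>k. t < \<tau> (Suc k)"])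
qed

lemma block_lower:
  assumes "\<tau> 0 = 0" "0 \<le> t"
  shows "\<tau> (block \<tau> t) \<le> t"
proof (cases "block \<tau> t")
  case (Suc k)
  then have "\<not> t < \<tau> (Suc k)" unfolding block_def by (metis lessI not_less_Least)
  then show ?thesis using Suc by simp
qed (use assms in simp)

lemma block_eqI:
  assumes "strict_mono \<tau>" "\<tau> k \<le> t" "t < \<tau> (Suc k)"
  shows "block \<tau> t = k"
  unfolding block_def
proof (rule Least_equality)
  fix j assume "t < \<tau> (Suc j)"
  then have "\<tau> k < \<tau> (Suc j)" using assms(2) by simp
  then show "k \<le> j" using assms(1) by (simp add: strict_mono_less)
qed (fact assms(3))

lemma block_mono:
  assumes "filterlim \<tau> at_top sequentially" "s \<le> t"
  shows "block \<tau> s \<le> block \<tau> t"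
  unfolding block_def[of \<tau> s] using block_upper[OF assms(1), of t] assms(2)
  by (intro Least_le) simp

lemma block_less:
  assumes "\<tau> 0 = 0" "filterlim \<tau> at_top sequentially" "0 \<le> s" "s < \<tau> k"
  shows "block \<tau> s < k"
proof (cases k)
  case (Suc j)
  then show ?thesis unfolding block_def using assms(4) by (simp add: Least_le less_Suc_eq_le)
qed (use assms in simp)

lemma measurable_block: "block \<tau> \<in> lebesgue_on S \<rightarrow>\<^sub>M count_space UNIV"
proof -
  have "block \<tau> \<in> borel \<rightarrow>\<^sub>M count_space UNIV" unfolding block_def by measurable
  then have "block \<tau> \<in> lborel \<rightarrow>\<^sub>M count_space UNIV" by simp
  then show ?thesis by (intro measurable_restrict_space1 measurable_completion)
qed

section \<open>Integrals of payoffs along controls\<close>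

lemma controls_mixed: "a \<in> controls \<Longrightarrow> 0 \<le> t \<Longrightarrow> a t \<in> mixed"
  by (auto simp: controls_def PiE_def)

lemma controls_measurable: "a \<in> controls \<Longrightarrow> a \<in> borel_measurable (lebesgue_on {0..})"
  by (simp add: controls_def)

lemma controlsI:
  assumes "\<And>t. 0 \<le> t \<Longrightarrow> f t \<in> mixed" "f \<in> borel_measurable (lebesgue_on {0..})"
  shows "restrict f {0..} \<in> controls"
proof -
  have "restrict f {0..} \<in> borel_measurable (lebesgue_on {0..}) \<longleftrightarrow> f \<in> borel_measurable (lebesgue_on {0..})"
    by (rule measurable_cong) (simp add: space_restrict_space)
  then show ?thesis using assms by (auto simp: controls_def)
qed

lemma controls_eqI:
  assumes "a \<in> controls" "b \<in> controls" "\<And>t. 0 \<le> t \<Longrightarrow> a t = b t"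
  shows "a = b"
  using assms by (intro extensionalityI[of a "{0..}" b]) (auto simp: controls_def PiE_def)

lemma absolutely_integrable_controls:
  fixes H :: "real ^ 'a::finite \<Rightarrow> real ^ 'b::finite \<Rightarrow> real ^ 'm::finite"
  assumes "bounded_bilinear H" "a \<in> controls" "b \<in> controls" "0 \<le> s"
  shows "(\<lambda>r. H (a r) (b r)) absolutely_integrable_on {s..t}"
proof -
  interpret H: bounded_bilinear H by fact
  obtain K where K: "\<And>p q. norm (H p q) \<le> norm p * norm q * K" "K > 0" using H.pos_bounded by blast
  have "(\<lambda>r. H (a r) (b r)) \<in> borel_measurable (lebesgue_on {0..})"
    by (rule borel_measurable_continuous_Pair[OF controls_measurable controls_measurable])
       (use assms in \<open>auto intro!: H.continuous_on continuous_intros\<close>)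
  then have "(\<lambda>r. H (a r) (b r)) \<in> borel_measurable (lebesgue_on {s..t})"
    using assms(4) by (elim measurable_restrict_mono) auto
  moreover have "norm (H (a r) (b r)) \<le> K" if "r \<in> {s..t}" for r
  proof -
    have "norm (a r) * norm (b r) \<le> 1"
      using that assms by (intro mult_le_one norm_mixed_le controls_mixed) auto
    then show ?thesis using K(1)[of "a r" "b r"] K(2) mult_right_mono[of "norm (a r) * norm (b r)" 1 K]
      by linarith
  qed
  ultimately show ?thesis
    by (intro measurable_bounded_by_integrable_imp_absolutely_integrable[where g="\<lambda>_. K"]) auto
qed

lemma integrable_control:
  assumes "a \<in> controls" "0 \<le> s"
  shows "a integrable_on {s..t}"
proof -
  have "a absolutely_integrable_on {s..t}"
  proof (rule measurable_bounded_by_integrable_imp_absolutely_integrable[where g="\<lambda>_. 1"])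
    show "a \<in> borel_measurable (lebesgue_on {s..t})"
      using controls_measurable[OF assms(1)] assms(2) by (elim measurable_restrict_mono) auto
    show "norm (a r) \<le> 1" if "r \<in> {s..t}" for r
      using that assms by (intro norm_mixed_le controls_mixed) auto
  qed auto
  then show ?thesis by (rule set_lebesgue_integral_eq_integral(1))
qed

text \<open>
  Averaging a control over time gives a mixed action. By bilinearity a payoff integral in which one
  player's mixed action is constant is thus the payoff of a single pair of mixed actions times the
  elapsed time.
\<close>

lemma control_mean:
  fixes a :: "real \<Rightarrow> real ^ 'n::finite"
  assumes "a \<in> controls" "0 \<le> s" "s < t"
  obtains m where "m \<in> mixed" "(a has_integral (t - s) *\<^sub>R m) {s..t}"
proof
  define m where "m = (1 / (t - s)) *\<^sub>R integral {s..t} a"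
  show m: "(a has_integral (t - s) *\<^sub>R m) {s..t}"
    using integrable_integral[OF integrable_control[OF assms(1,2), of t]] assms(3)
    by (simp add: m_def)
  have lin: "integral {s..t} (\<lambda>r. L (a r)) = (t - s) *\<^sub>R L m"
    if "bounded_linear L" for L :: "real ^ 'n \<Rightarrow> real"
    using integral_unique[OF has_integral_linear[OF m that]]
      linear_scale[OF bounded_linear.linear[OF that], of "t - s" m]
    by (simp add: o_def)
  have mix: "a r \<in> mixed" if "r \<in> {s..t}" for r using that assms by (auto intro: controls_mixed)
  have "m $ i \<ge> 0" for i
  proof -
    have "0 \<le> integral {s..t} (\<lambda>r. a r $ i)"
    proof (rule integral_nonneg)
      show "(\<lambda>r. a r $ i) integrable_on {s..t}"
        using has_integral_linear[OF m bounded_linear_vec_nth] by (auto simp: o_def integrable_on_def)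
    qed (use mix in \<open>simp add: mixed_def\<close>)
    then show ?thesis using lin[OF bounded_linear_vec_nth, of i] assms(3) by (simp add: zero_le_mult_iff)
  qed
  moreover have "(\<Sum>i\<in>UNIV. m $ i) = 1"
  proof -
    have "(t - s) *\<^sub>R (\<Sum>i\<in>UNIV. m $ i) = integral {s..t} (\<lambda>r. \<Sum>i\<in>UNIV. a r $ i)"
      by (rule lin[symmetric]) (intro bounded_linear_sum bounded_linear_vec_nth)
    also have "\<dots> = integral {s..t} (\<lambda>r. 1)"
      using mix by (intro integral_cong) (simp add: mixed_def)
    also have "\<dots> = t - s" using assms(3) by simp
    finally show ?thesis using assms(3) by simp
  qed
  ultimately show "m \<in> mixed" by (simp add: mixed_def)
qed

lemma constant_control: "q \<in> mixed \<Longrightarrow> restrict (\<lambda>_. q) {0..} \<in> controls"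
  by (rule controlsI) auto

lemma integral_payoff_left:
  fixes u :: "'a::finite \<Rightarrow> 'b::finite \<Rightarrow> real ^ 'm::finite"
  assumes "a \<in> controls" "0 \<le> s" "s < t"
  obtains m where "m \<in> mixed"
    "integral {s..t} (\<lambda>r. mixed_payoff u (a r) q) = (t - s) *\<^sub>R mixed_payoff u m q"
proof -
  interpret bounded_bilinear "mixed_payoff u" by (rule bounded_bilinear_mixed_payoff)
  obtain m where m: "m \<in> mixed" "(a has_integral (t - s) *\<^sub>R m) {s..t}"
    by (rule control_mean[OF assms])
  have "integral {s..t} (\<lambda>r. mixed_payoff u (a r) q) = (t - s) *\<^sub>R mixed_payoff u m q"
    using integral_unique[OF has_integral_linear[OF m(2) bounded_linear_left[of q]]]
    by (simp add: o_def scaleR_left)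
  with m(1) show ?thesis by (rule that)
qed

lemma integral_payoff_right:
  fixes u :: "'a::finite \<Rightarrow> 'b::finite \<Rightarrow> real ^ 'm::finite"
  assumes "b \<in> controls" "0 \<le> s" "s < t"
  obtains m where "m \<in> mixed"
    "integral {s..t} (\<lambda>r. mixed_payoff u p (b r)) = (t - s) *\<^sub>R mixed_payoff u p m"
proof -
  interpret bounded_bilinear "mixed_payoff u" by (rule bounded_bilinear_mixed_payoff)
  obtain m where m: "m \<in> mixed" "(b has_integral (t - s) *\<^sub>R m) {s..t}"
    by (rule control_mean[OF assms])
  have "integral {s..t} (\<lambda>r. mixed_payoff u p (b r)) = (t - s) *\<^sub>R mixed_payoff u p m"
    using integral_unique[OF has_integral_linear[OF m(2) bounded_linear_right[of p]]]
    by (simp add: o_def scaleR_right)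
  with m(1) show ?thesis by (rule that)
qed

lemma integrable_payoff:
  assumes "a \<in> controls" "b \<in> controls" "0 \<le> s"
  shows "(\<lambda>r. mixed_payoff u (a r) (b r)) integrable_on {s..t}"
  using absolutely_integrable_controls[OF bounded_bilinear_mixed_payoff assms]
  by (rule set_lebesgue_integral_eq_integral(1))

section \<open>Play paths\<close>

lemma strategies_controls: "\<sigma> \<in> strategies \<Longrightarrow> a \<in> controls \<Longrightarrow> \<sigma> a \<in> controls"
  by (auto simp: strategies_def)

text \<open>
  The rank \<open>N\<close> measures how often information has arrived. Defining causality by ranks instead of by
  one player's grid lets a single rank serve both players, and turns statements about play paths
  into inductions over natural numbers.
\<close>

definition causal_wrt ::
  "(real \<Rightarrow> nat) \<Rightarrow> ((real \<Rightarrow> real ^ 'o::finite) \<Rightarrow> (real \<Rightarrow> real ^ 'n::finite)) \<Rightarrow> bool" where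
  "causal_wrt N \<sigma> \<longleftrightarrow> (\<forall>a\<in>controls. \<forall>a'\<in>controls. \<forall>t\<ge>0.
     (\<forall>s\<ge>0. N s < N t \<longrightarrow> a s = a' s) \<longrightarrow> \<sigma> a t = \<sigma> a' t)"

lemma causal_wrtD:
  assumes "causal_wrt N \<sigma>" "a \<in> controls" "a' \<in> controls" "0 \<le> t"
    and "\<And>s. 0 \<le> s \<Longrightarrow> N s < N t \<Longrightarrow> a s = a' s"
  shows "\<sigma> a t = \<sigma> a' t"
  by (rule assms(1)[unfolded causal_wrt_def, rule_format, OF assms(2-5)])

lemma causal_wrt_refine:
  fixes \<sigma> :: "(real \<Rightarrow> real ^ 'o::finite) \<Rightarrow> (real \<Rightarrow> real ^ 'n::finite)"
  assumes N: "causal_wrt N \<sigma>" and less: "\<And>s t. N s < N t \<Longrightarrow> N' s < N' t"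
  shows "causal_wrt N' \<sigma>"
  unfolding causal_wrt_def
proof (intro ballI allI impI)
  fix a a' :: "real \<Rightarrow> real ^ 'o" and t
  assume A: "a \<in> controls" "a' \<in> controls" "0 \<le> t" "\<forall>s\<ge>0. N' s < N' t \<longrightarrow> a s = a' s"
  have "a s = a' s" if "0 \<le> s" "N s < N t" for s
    using A(4) less[OF that(2)] that(1) by metis
  then show "\<sigma> a t = \<sigma> a' t" by (rule causal_wrtD[OF N A(1-3)])
qed

lemma strategy_causal_wrt:
  fixes \<sigma> :: "(real \<Rightarrow> real ^ 'o::finite) \<Rightarrow> (real \<Rightarrow> real ^ 'n::finite)"
  assumes "\<sigma> \<in> strategies"
  obtains N where "mono N" "N \<in> lebesgue_on {0..} \<rightarrow>\<^sub>M count_space UNIV" "causal_wrt N \<sigma>"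
proof -
  obtain \<tau> where \<tau>: "\<tau> 0 = 0" "strict_mono \<tau>" "filterlim \<tau> at_top sequentially"
    and caus: "\<And>a a' k t. \<lbrakk>a \<in> controls; a' \<in> controls; \<And>s. s \<in> {0..<\<tau> k} \<Longrightarrow> a s = a' s;
      t \<in> {\<tau> k..<\<tau> (Suc k)}\<rbrakk> \<Longrightarrow> \<sigma> a t = \<sigma> a' t"
    using assms unfolding strategies_def by blast
  show ?thesis
  proof
    show "mono (block \<tau>)" using block_mono[OF \<tau>(3)] by (simp add: mono_def)
    show "block \<tau> \<in> lebesgue_on {0..} \<rightarrow>\<^sub>M count_space UNIV" by (rule measurable_block)
    show "causal_wrt (block \<tau>) \<sigma>"
      unfolding causal_wrt_def
    proof (intro ballI allI impI)
      fix a a' :: "real \<Rightarrow> real ^ 'o" and t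
      assume A: "a \<in> controls" "a' \<in> controls" "0 \<le> t"
        "\<forall>s\<ge>0. block \<tau> s < block \<tau> t \<longrightarrow> a s = a' s"
      show "\<sigma> a t = \<sigma> a' t"
      proof (rule caus[OF A(1,2)])
        show "t \<in> {\<tau> (block \<tau> t)..<\<tau> (Suc (block \<tau> t))}"
          using block_upper[OF \<tau>(3)] block_lower[of \<tau>, OF \<tau>(1) A(3)] by simp
        show "a s = a' s" if "s \<in> {0..<\<tau> (block \<tau> t)}" for s
          using that A(4) block_less[of \<tau>, OF \<tau>(1,3)] by simp
      qed
    qed
  qed
qed

text \<open>
  The sum of the two block indices works: ranks are monotone in time, so a strict increase of one
  summand is a strict increase of the sum.
\<close>

lemma strategies_common_rank:
  fixes \<sigma>1 :: "(real \<Rightarrow> real ^ 'b::finite) \<Rightarrow> (real \<Rightarrow> real ^ 'a::finite)"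
    and \<sigma>2 :: "(real \<Rightarrow> real ^ 'a) \<Rightarrow> (real \<Rightarrow> real ^ 'b)"
  assumes "\<sigma>1 \<in> strategies" "\<sigma>2 \<in> strategies"
  obtains N where "N \<in> lebesgue_on {0..} \<rightarrow>\<^sub>M count_space UNIV" "causal_wrt N \<sigma>1" "causal_wrt N \<sigma>2"
proof -
  obtain N1 where N1: "mono N1" "N1 \<in> lebesgue_on {0..} \<rightarrow>\<^sub>M count_space UNIV" "causal_wrt N1 \<sigma>1"
    by (rule strategy_causal_wrt[OF assms(1)])
  obtain N2 where N2: "mono N2" "N2 \<in> lebesgue_on {0..} \<rightarrow>\<^sub>M count_space UNIV" "causal_wrt N2 \<sigma>2"
    by (rule strategy_causal_wrt[OF assms(2)])
  have less: "N1 s + N2 s < N1 t + N2 t" if "N1 s < N1 t \<or> N2 s < N2 t" for s t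
  proof -
    have "s \<le> t"
    proof (rule ccontr)
      assume "\<not> s \<le> t"
      then show False using that monoD[OF N1(1), of t s] monoD[OF N2(1), of t s] by linarith
    qed
    then show ?thesis using that monoD[OF N1(1), of s t] monoD[OF N2(1), of s t] by linarith
  qed
  show ?thesis
  proof (rule that[of "\<lambda>t. N1 t + N2 t"])
    show "(\<lambda>t. N1 t + N2 t) \<in> lebesgue_on {0..} \<rightarrow>\<^sub>M count_space UNIV"
      by (intro measurable_compose_countable[OF measurable_compose[OF N2(2)] N1(2)]) simp
    show "causal_wrt (\<lambda>t. N1 t + N2 t) \<sigma>1"
      by (rule causal_wrt_refine[OF N1(3)]) (simp add: less)
    show "causal_wrt (\<lambda>t. N1 t + N2 t) \<sigma>2"
      by (rule causal_wrt_refine[OF N2(3)]) (simp add: less)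
  qed
qed

lemma play_path_unique:
  assumes "\<sigma>1 \<in> strategies" "\<sigma>2 \<in> strategies"
    and "a \<in> controls" "b \<in> controls" "\<sigma>1 b = a" "\<sigma>2 a = b"
    and "a' \<in> controls" "b' \<in> controls" "\<sigma>1 b' = a'" "\<sigma>2 a' = b'"
  shows "a = a'" "b = b'"
proof -
  obtain N where "N \<in> lebesgue_on {0..} \<rightarrow>\<^sub>M count_space UNIV"
    and N: "causal_wrt N \<sigma>1" "causal_wrt N \<sigma>2"
    by (rule strategies_common_rank[OF assms(1,2)])
  have eq: "0 \<le> t \<Longrightarrow> a t = a' t \<and> b t = b' t" for t
  proof (induction "N t" arbitrary: t rule: less_induct)
    case less
    have IH: "a s = a' s \<and> b s = b' s" if "0 \<le> s" "N s < N t" for s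
      using less.hyps[OF that(2,1)] .
    have "\<sigma>1 b t = \<sigma>1 b' t" by (rule causal_wrtD[OF N(1) assms(4,8) less.prems]) (simp add: IH)
    moreover have "\<sigma>2 a t = \<sigma>2 a' t" by (rule causal_wrtD[OF N(2) assms(3,7) less.prems]) (simp add: IH)
    ultimately show ?case by (simp add: assms(5,6,9,10))
  qed
  show "a = a'" by (rule controls_eqI[OF assms(3,7)]) (simp add: eq)
  show "b = b'" by (rule controls_eqI[OF assms(4,8)]) (simp add: eq)
qed

text \<open>
  Iterate the pair of strategies from arbitrary controls. Since the response at time \<open>t\<close> depends on
  times of lower rank only, the \<open>n\<close>-th iterate is final at all times of rank below \<open>n\<close>. Gluing the
  final values together gives the play path; it is measurable because the rank is.
\<close>

lemma play_path_exists:
  fixes \<sigma>1 :: "(real \<Rightarrow> real ^ 'b::finite) \<Rightarrow> (real \<Rightarrow> real ^ 'a::finite)"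
    and \<sigma>2 :: "(real \<Rightarrow> real ^ 'a) \<Rightarrow> (real \<Rightarrow> real ^ 'b)"
  assumes "\<sigma>1 \<in> strategies" "\<sigma>2 \<in> strategies"
  obtains a b where "a \<in> controls" "b \<in> controls" "\<sigma>1 b = a" "\<sigma>2 a = b"
proof -
  obtain N where meas: "N \<in> lebesgue_on {0..} \<rightarrow>\<^sub>M count_space UNIV"
    and N: "causal_wrt N \<sigma>1" "causal_wrt N \<sigma>2"
    by (rule strategies_common_rank[OF assms])
  obtain p0 :: "real^'a" where "p0 \<in> mixed" using mixed_nonempty by blast
  obtain q0 :: "real^'b" where "q0 \<in> mixed" using mixed_nonempty by blast
  define P where "P n = ((\<lambda>(a, b). (\<sigma>1 b, \<sigma>2 a)) ^^ n)
      (restrict (\<lambda>_. p0) {0..}, restrict (\<lambda>_. q0) {0..})" for n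
  define A where "A n = fst (P n)" for n
  define B where "B n = snd (P n)" for n
  have AB_Suc: "A (Suc n) = \<sigma>1 (B n)" "B (Suc n) = \<sigma>2 (A n)" for n
    by (simp_all add: A_def B_def P_def split_beta)
  have ctrl: "A n \<in> controls \<and> B n \<in> controls" for n
  proof (induction n)
    case 0
    show ?case using \<open>p0 \<in> mixed\<close> \<open>q0 \<in> mixed\<close> by (simp add: A_def B_def P_def constant_control del: restrict_apply)
  next
    case (Suc n)
    then show ?case using assms by (simp add: AB_Suc strategies_controls)
  qed
  have stab: "0 \<le> t \<Longrightarrow> N t < n \<Longrightarrow> N t < m \<Longrightarrow> A n t = A m t \<and> B n t = B m t" for t n m
  proof (induction "N t" arbitrary: t n m rule: less_induct)
    case less
    obtain n' m' where nm: "n = Suc n'" "m = Suc m'"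
      using less.prems(2,3) by (cases n; cases m) auto
    have IH: "A n' s = A m' s \<and> B n' s = B m' s" if "0 \<le> s" "N s < N t" for s
      using less.hyps[OF that(2,1), of n' m'] that(2) less.prems(2,3) nm by simp
    have "\<sigma>1 (B n') t = \<sigma>1 (B m') t"
      by (rule causal_wrtD[OF N(1)]) (simp_all add: ctrl less.prems IH)
    moreover have "\<sigma>2 (A n') t = \<sigma>2 (A m') t"
      by (rule causal_wrtD[OF N(2)]) (simp_all add: ctrl less.prems IH)
    ultimately show ?case by (simp add: nm AB_Suc)
  qed
  define a where "a = restrict (\<lambda>t. A (Suc (N t)) t) {0..}"
  define b where "b = restrict (\<lambda>t. B (Suc (N t)) t) {0..}"
  have a: "a \<in> controls" unfolding a_def
    by (intro controlsI controls_mixed measurable_compose_countable[OF _ meas, of "\<lambda>n. A (Suc n)"]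
        controls_measurable) (use ctrl in auto)
  have b: "b \<in> controls" unfolding b_def
    by (intro controlsI controls_mixed measurable_compose_countable[OF _ meas, of "\<lambda>n. B (Suc n)"]
        controls_measurable) (use ctrl in auto)
  have ab: "\<sigma>1 b t = a t" if "0 \<le> t" for t
  proof -
    have "\<sigma>1 b t = \<sigma>1 (B (N t)) t"
    proof (rule causal_wrtD[OF N(1) b _ that])
      show "b s = B (N t) s" if "0 \<le> s" "N s < N t" for s
        using stab[OF that(1) lessI that(2)] that(1) by (simp add: b_def)
    qed (simp add: ctrl)
    then show ?thesis using that by (simp add: a_def AB_Suc)
  qed
  have ba: "\<sigma>2 a t = b t" if "0 \<le> t" for t
  proof -
    have "\<sigma>2 a t = \<sigma>2 (A (N t)) t"
    proof (rule causal_wrtD[OF N(2) a _ that])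
      show "a s = A (N t) s" if "0 \<le> s" "N s < N t" for s
        using stab[OF that(1) lessI that(2)] that(1) by (simp add: a_def)
    qed (simp add: ctrl)
    then show ?thesis using that by (simp add: b_def AB_Suc)
  qed
  show ?thesis
  proof (rule that[OF a b])
    show "\<sigma>1 b = a" by (rule controls_eqI[OF strategies_controls[OF assms(1) b] a ab])
    show "\<sigma>2 a = b" by (rule controls_eqI[OF strategies_controls[OF assms(2) a] b ba])
  qed
qed

lemma cumulative_payoff_eq_integral:
  assumes "\<sigma>1 \<in> strategies" "\<sigma>2 \<in> strategies"
    and "a \<in> controls" "b \<in> controls" "\<sigma>1 b = a" "\<sigma>2 a = b"
  shows "cumulative_payoff u \<sigma>1 \<sigma>2 t = integral {0..t} (\<lambda>s. mixed_payoff u (a s) (b s))"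
proof -
  have "play_path \<sigma>1 \<sigma>2 = (a, b)"
    unfolding play_path_def
  proof (rule the_equality)
    fix c assume "case c of (a1, a2) \<Rightarrow> a1 \<in> controls \<and> a2 \<in> controls \<and> \<sigma>1 a2 = a1 \<and> \<sigma>2 a1 = a2"
    then have c: "fst c \<in> controls" "snd c \<in> controls" "\<sigma>1 (snd c) = fst c" "\<sigma>2 (fst c) = snd c"
      by (simp_all add: split_beta)
    show "c = (a, b)"
      by (rule prod_eqI) (simp_all add: play_path_unique[OF assms(1,2) c assms(3-6)])
  qed (simp add: assms)
  then have "cumulative_payoff u \<sigma>1 \<sigma>2 t = (LINT s:{0..t}|lebesgue. mixed_payoff u (a s) (b s))"
    unfolding cumulative_payoff_def by simp
  also have "\<dots> = integral {0..t} (\<lambda>s. mixed_payoff u (a s) (b s))"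
    by (intro set_lebesgue_integral_eq_integral(2) absolutely_integrable_controls
        bounded_bilinear_mixed_payoff assms(3,4) order_refl)
  finally show ?thesis .
qed

section \<open>Strategies that are constant on blocks\<close>

text \<open>
  The controls produced are functions of the block index, hence measurable however irregularly \<open>f\<close>
  depends on the opponent's past.
\<close>

lemma block_strategy:
  fixes f :: "(real \<Rightarrow> real ^ 'o::finite) \<Rightarrow> nat \<Rightarrow> real ^ 'n::finite"
  assumes \<tau>: "\<tau> 0 = 0" "strict_mono \<tau>" "filterlim \<tau> at_top sequentially"
    and mixed: "\<And>b k. b \<in> controls \<Longrightarrow> f b k \<in> mixed"
    and past: "\<And>b b' k. \<lbrakk>b \<in> controls; b' \<in> controls; \<And>t. t \<in> {0..<\<tau> k} \<Longrightarrow> b t = b' t\<rbrakk> \<Longrightarrow> f b k = f b' k"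
  shows "(\<lambda>b. restrict (\<lambda>t. f b (block \<tau> t)) {0..}) \<in> strategies"
proof -
  let ?\<sigma> = "\<lambda>b. restrict (\<lambda>t. f b (block \<tau> t)) {0..}"
  have "?\<sigma> \<in> controls \<rightarrow> controls"
  proof (intro Pi_I controlsI)
    fix b :: "real \<Rightarrow> real ^ 'o" and t :: real
    assume "b \<in> controls"
    then show "f b (block \<tau> t) \<in> mixed" by (rule mixed)
    show "(\<lambda>t. f b (block \<tau> t)) \<in> borel_measurable (lebesgue_on {0..})"
      by (rule measurable_compose[OF measurable_block]) simp
  qed
  moreover have "?\<sigma> a t = ?\<sigma> a' t"
    if "a \<in> controls" "a' \<in> controls" "\<forall>t\<in>{0..<\<tau> k}. a t = a' t" "t \<in> {\<tau> k..<\<tau> (Suc k)}" for a a' k t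
  proof -
    have "block \<tau> t = k" using that(4) by (intro block_eqI[OF \<tau>(2)]) auto
    moreover have "f a k = f a' k" using that(3) by (intro past[OF that(1,2)]) blast
    ultimately show ?thesis by (simp add: restrict_def)
  qed
  ultimately show ?thesis
    unfolding strategies_def using \<tau> by blast
qed

lemma constant_strategy:
  assumes "q \<in> mixed"
  shows "(\<lambda>_. restrict (\<lambda>_. q) {0..}) \<in> strategies"
  by (rule block_strategy[of real "\<lambda>_ _. q"])
     (simp_all add: assms strict_mono_def filterlim_real_sequentially)

section \<open>Attainability forces achievability\<close>

text \<open>
  Against an opponent who always plays \<open>q\<close>, the payoff over an interval is the payoff of Player 1's
  average action there. The interval \<open>[0,T]\<close> must earn almost \<open>x\<close>; the interval \<open>[T,T+1]\<close> must earn
  almost \<open>0\<close>, since the cumulative payoff is near \<open>x\<close> at both of its ends.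
\<close>

lemma attainable_imp_achievable:
  fixes u :: "'a::finite \<Rightarrow> 'b::finite \<Rightarrow> real ^ 'm::finite"
  assumes "attainable u x"
  shows "achievable u 0" "\<exists>T>0. achievable u ((1 / T) *\<^sub>R x)"
proof -
  obtain T where T: "T > 0" and att: "\<And>\<epsilon>. \<epsilon> > 0 \<Longrightarrow> \<exists>\<sigma>1\<in>strategies. \<forall>t\<ge>T. \<forall>\<sigma>2\<in>strategies.
      infdist (cumulative_payoff u \<sigma>1 \<sigma>2 t) {x} \<le> \<epsilon>"
    using assms unfolding attainable_def attainable_set_def by blast
  have path: "\<exists>a\<in>controls. \<forall>t\<ge>T. norm (integral {0..t} (\<lambda>s. mixed_payoff u (a s) q) - x) \<le> \<epsilon>"
    if q: "q \<in> mixed" and "\<epsilon> > 0" for q \<epsilon>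
  proof -
    obtain \<sigma>1 where \<sigma>1: "\<sigma>1 \<in> strategies" "\<And>t \<sigma>2. \<lbrakk>t \<ge> T; \<sigma>2 \<in> strategies\<rbrakk> \<Longrightarrow>
        infdist (cumulative_payoff u \<sigma>1 \<sigma>2 t) {x} \<le> \<epsilon>"
      using att[OF \<open>\<epsilon> > 0\<close>] by blast
    define b where "b = restrict (\<lambda>_::real. q) {0..}"
    define a where "a = \<sigma>1 b"
    have b: "b \<in> controls" unfolding b_def by (rule constant_control[OF q])
    have a: "a \<in> controls" unfolding a_def by (rule strategies_controls[OF \<sigma>1(1) b])
    have \<sigma>2: "(\<lambda>_. b) \<in> strategies" unfolding b_def by (rule constant_strategy[OF q])
    have "norm (integral {0..t} (\<lambda>s. mixed_payoff u (a s) q) - x) \<le> \<epsilon>" if "t \<ge> T" for t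
    proof -
      have "cumulative_payoff u \<sigma>1 (\<lambda>_. b) t = integral {0..t} (\<lambda>s. mixed_payoff u (a s) (b s))"
        by (rule cumulative_payoff_eq_integral[OF \<sigma>1(1) \<sigma>2 a b a_def[symmetric] refl])
      also have "\<dots> = integral {0..t} (\<lambda>s. mixed_payoff u (a s) q)"
        by (rule integral_cong) (simp add: b_def)
      finally show ?thesis using \<sigma>1(2)[OF that \<sigma>2] by (simp add: dist_norm)
    qed
    with a show ?thesis by blast
  qed
  have int: "(\<lambda>s. mixed_payoff u (a s) q) integrable_on {0..t}" if "a \<in> controls" for a t q
    using integrable_linear[OF integrable_control[OF that order_refl]
        bounded_bilinear.bounded_linear_left[OF bounded_bilinear_mixed_payoff]]
    by (simp add: o_def)
  show "achievable u 0"
  proof (rule achievable_approx)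
    fix q :: "real^'b" and e :: real assume "q \<in> mixed" "e > 0"
    then obtain a where a: "a \<in> controls"
      "\<And>t. t \<ge> T \<Longrightarrow> norm (integral {0..t} (\<lambda>s. mixed_payoff u (a s) q) - x) \<le> e / 3"
      using path[of q "e / 3"] by auto
    obtain m where m: "m \<in> mixed"
      "integral {T..T + 1} (\<lambda>s. mixed_payoff u (a s) q) = (T + 1 - T) *\<^sub>R mixed_payoff u m q"
      using integral_payoff_left[OF a(1), of T "T + 1"] T by (metis less_add_one less_imp_le)
    have "mixed_payoff u m q = (integral {0..T + 1} (\<lambda>s. mixed_payoff u (a s) q) - x)
        - (integral {0..T} (\<lambda>s. mixed_payoff u (a s) q) - x)"
      using Henstock_Kurzweil_Integration.integral_combine[OF _ _ int[OF a(1)], of T "T + 1" q] m(2) T by (simp add: algebra_simps)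
    then have "norm (mixed_payoff u m q) \<le> e / 3 + e / 3"
      using a(2)[of "T + 1"] a(2)[of T] by (metis add_mono less_add_one less_imp_le norm_triangle_le_diff order_refl)
    then show "\<exists>p\<in>mixed. norm (mixed_payoff u p q - 0) < e"
      using m(1) \<open>e > 0\<close> by (intro bexI[of _ m]) auto
  qed
  have "achievable u ((1 / T) *\<^sub>R x)"
  proof (rule achievable_approx)
    fix q :: "real^'b" and e :: real assume "q \<in> mixed" "e > 0"
    then obtain a where a: "a \<in> controls"
      "norm (integral {0..T} (\<lambda>s. mixed_payoff u (a s) q) - x) \<le> T * e / 2"
      using path[of q "T * e / 2"] T by auto
    obtain m where m: "m \<in> mixed"
      "integral {0..T} (\<lambda>s. mixed_payoff u (a s) q) = (T - 0) *\<^sub>R mixed_payoff u m q"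
      using integral_payoff_left[OF a(1) order_refl T] by metis
    have "T *\<^sub>R mixed_payoff u m q - x = T *\<^sub>R (mixed_payoff u m q - (1 / T) *\<^sub>R x)"
      using T by (simp add: algebra_simps)
    then have "T * norm (mixed_payoff u m q - (1 / T) *\<^sub>R x) \<le> T * (e / 2)"
      using a(2) m(2) T by simp
    then have "norm (mixed_payoff u m q - (1 / T) *\<^sub>R x) \<le> e / 2"
      using T by (simp add: mult_le_cancel_left_pos)
    then show "\<exists>p\<in>mixed. norm (mixed_payoff u p q - (1 / T) *\<^sub>R x) < e"
      using m(1) \<open>e > 0\<close> by (intro bexI[of _ m]) auto
  qed
  with T show "\<exists>T>0. achievable u ((1 / T) *\<^sub>R x)" by blast
qed

section \<open>Tracking a moving target\<close>

text \<open>
  Correcting a deviation \<open>d\<close> by a move \<open>w\<close> that does not point outwards: the cross term of the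
  squared norm is nonpositive, so squared errors add up at worst as for orthogonal moves.
\<close>

lemma blackwell_step:
  fixes d w :: "'v::real_inner"
  assumes "d \<bullet> w \<le> 0" "norm w \<le> c"
  shows "(norm (d + w))\<^sup>2 \<le> (norm d)\<^sup>2 + c\<^sup>2"
proof -
  have "(norm (d + w))\<^sup>2 = (norm d)\<^sup>2 + 2 * (d \<bullet> w) + (norm w)\<^sup>2"
    by (simp add: power2_norm_eq_inner inner_add_left inner_add_right inner_commute)
  moreover have "(norm w)\<^sup>2 \<le> c\<^sup>2" using assms(2) by (intro power_mono) simp_all
  ultimately show ?thesis using assms(1) by linarith
qed

text \<open>
  The induction step for \<open>\<Sum>j=1..k. 1/j\<^sup>2 \<le> 2 - 2/(k+1)\<close>, which bounds the total squared length of
  the harmonic blocks.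
\<close>

lemma inverse_squares_step:
  "2 - 2 / real (Suc k) + 1 / (real (Suc k))\<^sup>2 \<le> 2 - 2 / real (Suc (Suc k))"
proof -
  have "1 / (real (Suc k))\<^sup>2 \<le> 2 / (real (Suc k) * real (Suc (Suc k)))"
    by (simp add: divide_simps power2_eq_square)
  also have "\<dots> = 2 / real (Suc k) - 2 / real (Suc (Suc k))" by (simp add: field_simps)
  finally show ?thesis by simp
qed

text \<open>
  Blackwell's strategy for a moving target \<open>y\<close>: what makes the target trackable is that its mean
  velocity over every time interval is achievable. On the grid \<open>r (1 + 1/2 + \<dots> + 1/k)\<close>, Player 1
  plays on each block the minimax answer in the direction of the deviation \<open>dev b k\<close> at the start
  of the block, for the mean velocity \<open>c k\<close> of the target on that block. The deviation can be
  computed from the past of the opponent's control \<open>b\<close> alone, since it determines Player 1's own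
  actions recursively.
\<close>

lemma tracking_strategy:
  fixes u :: "'a::finite \<Rightarrow> 'b::finite \<Rightarrow> real ^ 'm::finite" and y :: "real \<Rightarrow> real ^ 'm"
  assumes y0: "y 0 = 0"
    and rate: "\<And>s t. 0 \<le> s \<Longrightarrow> s < t \<Longrightarrow> \<exists>c. achievable u c \<and> y t - y s = (t - s) *\<^sub>R c"
    and \<epsilon>: "\<epsilon> > 0"
  shows "\<exists>\<sigma>1\<in>strategies. \<forall>\<sigma>2\<in>strategies. \<forall>t\<ge>0. norm (cumulative_payoff u \<sigma>1 \<sigma>2 t - y t) \<le> \<epsilon>"
proof -
  obtain K where K: "K > 0" "\<And>p q. p \<in> mixed \<Longrightarrow> q \<in> mixed \<Longrightarrow> norm (mixed_payoff u p q) \<le> K"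
    using bounded_mixed_payoff[of u] by blast
  have bnd: "norm (mixed_payoff u p q - c) \<le> 2 * K" if "p \<in> mixed" "q \<in> mixed" "achievable u c" for p q c
  proof -
    obtain p' where "p' \<in> mixed" "mixed_payoff u p' q = c"
      using \<open>achievable u c\<close> \<open>q \<in> mixed\<close> unfolding achievable_def by blast
    then have "norm c \<le> K" using K(2) \<open>q \<in> mixed\<close> by blast
    then show ?thesis using K(2)[OF that(1,2)] norm_triangle_ineq4[of "mixed_payoff u p q" c] by linarith
  qed
  \<comment> \<open>payoff minus velocity has norm at most \<open>2 * K\<close>, so a block of length \<open>r\<close> moves the deviation by at most \<open>\<epsilon> / 4\<close>\<close>
  define r where "r = \<epsilon> / (8 * K)"
  have r: "r > 0" using \<epsilon> K(1) by (simp add: r_def)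
  have Kr: "2 * K * r = \<epsilon> / 4" using K(1) by (simp add: r_def)
  define \<tau> :: "nat \<Rightarrow> real" where "\<tau> k = r * harm k" for k
  have step: "\<tau> (Suc k) = \<tau> k + r / real (Suc k)" for k
    by (simp add: \<tau>_def harm_Suc distrib_left divide_inverse)
  have lt: "\<tau> k < \<tau> (Suc k)" for k using r unfolding step by simp
  have \<tau>0: "\<tau> 0 = 0" by (simp add: \<tau>_def harm_def)
  have \<tau>_mono: "strict_mono \<tau>" using lt by (rule strict_monoI_Suc)
  have \<tau>_top: "filterlim \<tau> at_top sequentially"
    unfolding \<tau>_def by (rule filterlim_tendsto_pos_mult_at_top[OF tendsto_const r harm_at_top])
  have \<tau>_nonneg: "0 \<le> \<tau> k" for k
    using monoD[OF strict_mono_mono[OF \<tau>_mono], of 0 k] \<tau>0 by simp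
  define h where "h k = r / real (Suc k)" for k
  have h: "0 < h k" "h k \<le> r" "\<tau> (Suc k) = \<tau> k + h k" for k
    using r by (simp_all add: h_def step divide_le_eq)
  have "\<forall>k. \<exists>c. achievable u c \<and> y (\<tau> (Suc k)) - y (\<tau> k) = h k *\<^sub>R c"
    using rate[OF \<tau>_nonneg lt] by (simp add: h(3))
  then obtain c where c: "\<And>k. achievable u (c k)"
    "\<And>k. y (\<tau> (Suc k)) - y (\<tau> k) = h k *\<^sub>R c k" by metis
  have "\<forall>k d. \<exists>p. p \<in> mixed \<and> (\<forall>q\<in>mixed. d \<bullet> (mixed_payoff u p q - c k) \<le> 0)"
    using achievable_minimax[OF c(1)] by blast
  then obtain pick where pick: "\<And>k d. pick k d \<in> mixed"
    "\<And>k d q. q \<in> mixed \<Longrightarrow> d \<bullet> (mixed_payoff u (pick k d) q - c k) \<le> 0" by metis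
  define dev :: "(real \<Rightarrow> real ^ 'b) \<Rightarrow> nat \<Rightarrow> real ^ 'm" where "dev b = rec_nat 0 (\<lambda>k d. d +
      (integral {\<tau> k..\<tau> (Suc k)} (\<lambda>s. mixed_payoff u (pick k d) (b s)) - h k *\<^sub>R c k))" for b
  have dev_0: "dev b 0 = 0" for b by (simp add: dev_def)
  have dev_Suc: "dev b (Suc k) = dev b k +
      (integral {\<tau> k..\<tau> (Suc k)} (\<lambda>s. mixed_payoff u (pick k (dev b k)) (b s)) - h k *\<^sub>R c k)" for b k
    by (simp add: dev_def)
  have dev_past: "dev b k = dev b' k" if "\<And>t. t \<in> {0..<\<tau> k} \<Longrightarrow> b t = b' t" for b b' k
    using that
  proof (induction k)
    case (Suc k)
    have "dev b k = dev b' k" by (rule Suc.IH, rule Suc.prems) (use lt[of k] in auto)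
    moreover have "integral {\<tau> k..\<tau> (Suc k)} (\<lambda>s. mixed_payoff u p (b s))
        = integral {\<tau> k..\<tau> (Suc k)} (\<lambda>s. mixed_payoff u p (b' s))" for p
    \<comment> \<open>the past excludes the right end point, which does not matter for the integral\<close>
    proof (rule integral_spike[OF negligible_sing[of "\<tau> (Suc k)"]])
      fix s assume "s \<in> {\<tau> k..\<tau> (Suc k)} - {\<tau> (Suc k)}"
      then have "b s = b' s" using \<tau>_nonneg[of k] by (intro Suc.prems) auto
      then show "mixed_payoff u p (b' s) = mixed_payoff u p (b s)" by simp
    qed
    ultimately show ?case unfolding dev_Suc by simp
  qed (simp add: dev_0)
  define \<sigma>1 where "\<sigma>1 b = restrict (\<lambda>t. pick (block \<tau> t) (dev b (block \<tau> t))) {0..}" for b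
  have \<sigma>1: "\<sigma>1 \<in> strategies"
    unfolding \<sigma>1_def
  proof (rule block_strategy[OF \<tau>0 \<tau>_mono \<tau>_top, of "\<lambda>b k. pick k (dev b k)"])
    show "pick k (dev b k) \<in> mixed" for b k by (rule pick(1))
    fix b b' :: "real \<Rightarrow> real ^ 'b" and k
    assume "\<And>t. t \<in> {0..<\<tau> k} \<Longrightarrow> b t = b' t"
    then have "dev b k = dev b' k" by (rule dev_past)
    then show "pick k (dev b k) = pick k (dev b' k)" by simp
  qed
  have "norm (cumulative_payoff u \<sigma>1 \<sigma>2 t - y t) \<le> \<epsilon>" if \<sigma>2: "\<sigma>2 \<in> strategies" and t: "t \<ge> 0" for \<sigma>2 t
  proof -
    obtain a b where ab: "a \<in> controls" "b \<in> controls" "\<sigma>1 b = a" "\<sigma>2 a = b"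
      by (rule play_path_exists[OF \<sigma>1 \<sigma>2])
    define F where "F s = mixed_payoff u (a s) (b s)" for s
    have F_int: "F integrable_on {s..t}" if "0 \<le> s" for s t
      unfolding F_def using integrable_payoff[OF ab(1,2) that] .
    have F_block: "integral {\<tau> k..t} F = integral {\<tau> k..t} (\<lambda>s. mixed_payoff u (pick k (dev b k)) (b s))"
      if "t \<le> \<tau> (Suc k)" for k t
    proof (rule integral_spike[OF negligible_sing[of "\<tau> (Suc k)"]])
      fix s assume s: "s \<in> {\<tau> k..t} - {\<tau> (Suc k)}"
      have "block \<tau> s = k" by (rule block_eqI[OF \<tau>_mono]) (use s that in auto)
      moreover have "0 \<le> s" using s \<tau>_nonneg[of k] by auto
      ultimately have "a s = pick k (dev b k)" unfolding ab(3)[symmetric] \<sigma>1_def by simp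
      then show "mixed_payoff u (pick k (dev b k)) (b s) = F s" by (simp add: F_def)
    qed
    have F_mean: "\<exists>m\<in>mixed. integral {\<tau> k..t} F = (t - \<tau> k) *\<^sub>R mixed_payoff u (pick k (dev b k)) m"
      if t: "\<tau> k < t" "t \<le> \<tau> (Suc k)" for k t
    proof -
      obtain m where "m \<in> mixed" "integral {\<tau> k..t} (\<lambda>s. mixed_payoff u (pick k (dev b k)) (b s))
          = (t - \<tau> k) *\<^sub>R mixed_payoff u (pick k (dev b k)) m"
        by (rule integral_payoff_right[OF ab(2) \<tau>_nonneg t(1)])
      then show ?thesis unfolding F_block[OF t(2)] by blast
    qed
    have dev_eq: "integral {0..\<tau> k} F - y (\<tau> k) = dev b k" for k
    proof (induction k)
      case 0
      show ?case by (simp add: \<tau>0 y0 dev_0)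
    next
      case (Suc k)
      have "integral {0..\<tau> (Suc k)} F = integral {0..\<tau> k} F + integral {\<tau> k..\<tau> (Suc k)} F"
        by (rule Henstock_Kurzweil_Integration.integral_combine[symmetric, OF \<tau>_nonneg less_imp_le[OF lt] F_int]) simp
      moreover have "y (\<tau> (Suc k)) = y (\<tau> k) + h k *\<^sub>R c k" using c(2)[of k] by (simp add: algebra_simps)
      ultimately show ?case using Suc by (simp add: dev_Suc F_block algebra_simps)
    qed
    have dev_sq: "(norm (dev b k))\<^sup>2 \<le> (\<epsilon> / 4)\<^sup>2 * (2 - 2 / real (Suc k))" for k
    proof (induction k)
      case 0
      show ?case by (simp add: dev_0)
    next
      case (Suc k)
      obtain m where m: "m \<in> mixed" "integral {\<tau> k..\<tau> (Suc k)} F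
          = (\<tau> (Suc k) - \<tau> k) *\<^sub>R mixed_payoff u (pick k (dev b k)) m"
        using F_mean[OF lt order_refl] by blast
      define w where "w = h k *\<^sub>R (mixed_payoff u (pick k (dev b k)) m - c k)"
      have dev: "dev b (Suc k) = dev b k + w"
        using m(2) by (simp add: dev_Suc F_block[symmetric] w_def h(3) scaleR_diff_right)
      have "dev b k \<bullet> w \<le> 0"
        using pick(2)[OF m(1), of "dev b k" k] h(1)[of k] by (simp add: w_def mult_le_0_iff)
      moreover have "norm w \<le> (\<epsilon> / 4) / real (Suc k)"
      proof -
        have "norm w = h k * norm (mixed_payoff u (pick k (dev b k)) m - c k)"
          using h(1)[of k] by (simp add: w_def)
        also have "\<dots> \<le> h k * (2 * K)"
          using h(1)[of k] bnd[OF pick(1) m(1) c(1)] by (intro mult_left_mono) simp_all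
        also have "\<dots> = (\<epsilon> / 4) / real (Suc k)" unfolding Kr[symmetric] h_def by simp
        finally show ?thesis .
      qed
      ultimately have "(norm (dev b (Suc k)))\<^sup>2 \<le> (norm (dev b k))\<^sup>2 + ((\<epsilon> / 4) / real (Suc k))\<^sup>2"
        unfolding dev by (rule blackwell_step)
      also have "\<dots> \<le> (\<epsilon> / 4)\<^sup>2 * (2 - 2 / real (Suc k)) + (\<epsilon> / 4)\<^sup>2 * (1 / (real (Suc k))\<^sup>2)"
        by (rule add_mono[OF Suc]) (simp only: power_divide times_divide_eq_right mult_1_right order_refl)
      also have "\<dots> = (\<epsilon> / 4)\<^sup>2 * (2 - 2 / real (Suc k) + 1 / (real (Suc k))\<^sup>2)" by (simp only: distrib_left)
      also have "\<dots> \<le> (\<epsilon> / 4)\<^sup>2 * (2 - 2 / real (Suc (Suc k)))"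
        by (rule mult_left_mono[OF inverse_squares_step]) simp
      finally show ?case .
    qed
    have dev_le: "norm (dev b k) \<le> \<epsilon> / 2" for k
    proof (rule power2_le_imp_le)
      have "(norm (dev b k))\<^sup>2 \<le> (\<epsilon> / 4)\<^sup>2 * (2 - 2 / real (Suc k))" by (rule dev_sq)
      also have "\<dots> \<le> (\<epsilon> / 4)\<^sup>2 * 4"
      proof (rule mult_left_mono)
        have "0 \<le> 2 / real (Suc k)" by simp
        then show "2 - 2 / real (Suc k) \<le> 4" by linarith
      qed simp
      also have "\<dots> = (\<epsilon> / 2)\<^sup>2" by (simp add: power2_eq_square)
      finally show "(norm (dev b k))\<^sup>2 \<le> (\<epsilon> / 2)\<^sup>2" .
    qed (use \<epsilon> in simp)
    define k where "k = block \<tau> t"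
    have k: "\<tau> k \<le> t" "t < \<tau> (Suc k)"
      unfolding k_def using block_lower[of \<tau>, OF \<tau>0 t] block_upper[OF \<tau>_top] by simp_all
    \<comment> \<open>inside a block the answer need not be good; the short block bounds the drift\<close>
    have rest: "norm (integral {\<tau> k..t} F - (y t - y (\<tau> k))) \<le> \<epsilon> / 4"
    proof (cases "\<tau> k = t")
      case True
      then show ?thesis using \<epsilon> by simp
    next
      case False
      then have "\<tau> k < t" using k(1) by simp
      obtain m where m: "m \<in> mixed" "integral {\<tau> k..t} F = (t - \<tau> k) *\<^sub>R mixed_payoff u (pick k (dev b k)) m"
        using F_mean[OF \<open>\<tau> k < t\<close> less_imp_le[OF k(2)]] by blast
      obtain e where e: "achievable u e" "y t - y (\<tau> k) = (t - \<tau> k) *\<^sub>R e"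
        using rate[OF \<tau>_nonneg \<open>\<tau> k < t\<close>] by blast
      have "norm (integral {\<tau> k..t} F - (y t - y (\<tau> k)))
          = (t - \<tau> k) * norm (mixed_payoff u (pick k (dev b k)) m - e)"
        using \<open>\<tau> k < t\<close> by (simp add: m(2) e(2) flip: scaleR_diff_right)
      also have "\<dots> \<le> r * (2 * K)"
        using h(2,3)[of k] k r bnd[OF pick(1) m(1) e(1)] by (intro mult_mono) simp_all
      also have "\<dots> = \<epsilon> / 4" using Kr by (simp add: mult.commute)
      finally show ?thesis .
    qed
    have "integral {0..t} F - y t = dev b k + (integral {\<tau> k..t} F - (y t - y (\<tau> k)))"
      using Henstock_Kurzweil_Integration.integral_combine[OF \<tau>_nonneg k(1) F_int[OF order_refl]] dev_eq[of k]
      by (simp add: algebra_simps)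
    then have "norm (integral {0..t} F - y t) \<le> \<epsilon> / 2 + \<epsilon> / 4"
      by (simp only: norm_triangle_mono[OF dev_le rest])
    moreover have "cumulative_payoff u \<sigma>1 \<sigma>2 t = integral {0..t} F"
      using cumulative_payoff_eq_integral[OF \<sigma>1 \<sigma>2 ab, of u t] by (simp add: F_def[abs_def])
    ultimately show ?thesis using \<epsilon> by simp
  qed
  with \<sigma>1 show ?thesis by blast
qed

text \<open>
  The target \<open>min (t/T) 1 \<cdot> x\<close> starts at \<open>0\<close>, is at \<open>x\<close> from time \<open>T\<close> on, and has mean velocities
  between \<open>0\<close> and \<open>x/T\<close>. The tracking error is small at all times, whence the same \<open>T\<close> serves for
  every \<open>\<epsilon>\<close>.
\<close>

lemma attainableI:
  fixes u :: "'a::finite \<Rightarrow> 'b::finite \<Rightarrow> real ^ 'm::finite"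
  assumes zero: "achievable u 0" and T: "T > 0" and x: "achievable u ((1 / T) *\<^sub>R x)"
  shows "attainable u x"
proof -
  define y where "y t = min (t / T) 1 *\<^sub>R x" for t
  have rate: "\<exists>c. achievable u c \<and> y t - y s = (t - s) *\<^sub>R c" if "0 \<le> s" "s < t" for s t
  proof -
    \<comment> \<open>the weight of the velocity \<open>x / T\<close>: the share of the interval that lies before \<open>T\<close>\<close>
    define \<theta> where "\<theta> = T * (min (t / T) 1 - min (s / T) 1) / (t - s)"
    have le: "s / T < t / T" using that T by (simp add: divide_strict_right_mono)
    have "0 \<le> \<theta>" unfolding \<theta>_def using that T le by (intro divide_nonneg_pos mult_nonneg_nonneg) auto
    moreover have "\<theta> \<le> 1"
    proof -
      have "min (t / T) 1 - min (s / T) 1 \<le> t / T - s / T" using le by simp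
      then have "T * (min (t / T) 1 - min (s / T) 1) \<le> T * (t / T - s / T)"
        using T by (intro mult_left_mono) simp_all
      also have "\<dots> = t - s" using T by (simp add: right_diff_distrib)
      finally show ?thesis using that(2) by (simp add: \<theta>_def)
    qed
    ultimately have "achievable u (\<theta> *\<^sub>R (1 / T) *\<^sub>R x + (1 - \<theta>) *\<^sub>R 0)"
      by (intro achievable_convex x zero) simp_all
    moreover have "y t - y s = (t - s) *\<^sub>R (\<theta> *\<^sub>R (1 / T) *\<^sub>R x + (1 - \<theta>) *\<^sub>R 0)"
      using that(2) T by (simp add: y_def \<theta>_def flip: scaleR_diff_left)
    ultimately show ?thesis by blast
  qed
  have "\<exists>\<sigma>1\<in>strategies. \<forall>t\<ge>T. \<forall>\<sigma>2\<in>strategies. infdist (cumulative_payoff u \<sigma>1 \<sigma>2 t) {x} \<le> \<epsilon>"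
    if "\<epsilon> > 0" for \<epsilon>
  proof -
    obtain \<sigma>1 where \<sigma>1: "\<sigma>1 \<in> strategies"
      "\<And>\<sigma>2 t. \<sigma>2 \<in> strategies \<Longrightarrow> t \<ge> 0 \<Longrightarrow> norm (cumulative_payoff u \<sigma>1 \<sigma>2 t - y t) \<le> \<epsilon>"
      using tracking_strategy[OF _ rate \<open>\<epsilon> > 0\<close>] by (auto simp: y_def)
    have "infdist (cumulative_payoff u \<sigma>1 \<sigma>2 t) {x} \<le> \<epsilon>" if "t \<ge> T" "\<sigma>2 \<in> strategies" for t \<sigma>2
    proof -
      have "y t = x" using that(1) T by (simp add: y_def)
      then show ?thesis using \<sigma>1(2)[OF that(2), of t] that(1) T by (simp add: dist_norm)
    qed
    with \<sigma>1(1) show ?thesis by blast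
  qed
  with T show ?thesis unfolding attainable_def attainable_set_def by blast
qed

section \<open>Equivalence of the conditions\<close>

text \<open>
  The scalar \<open>\<delta>\<close> is the reciprocal of the time \<open>T\<close> at which \<open>x\<close> is reached.
\<close>

lemma attainable_iff_achievable:
  "attainable u x \<longleftrightarrow> achievable u 0 \<and> (\<exists>\<delta>>0. achievable u (\<delta> *\<^sub>R x))"
proof
  assume att: "attainable u x"
  obtain T where "T > 0" "achievable u ((1 / T) *\<^sub>R x)"
    using attainable_imp_achievable(2)[OF att] by blast
  then have "\<exists>\<delta>>0. achievable u (\<delta> *\<^sub>R x)" by (intro exI[of _ "1 / T"]) simp
  with attainable_imp_achievable(1)[OF att] show "achievable u 0 \<and> (\<exists>\<delta>>0. achievable u (\<delta> *\<^sub>R x))" ..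
next
  assume "achievable u 0 \<and> (\<exists>\<delta>>0. achievable u (\<delta> *\<^sub>R x))"
  then obtain \<delta> where "achievable u 0" "\<delta> > 0" "achievable u (\<delta> *\<^sub>R x)" by blast
  then show "attainable u x" by (intro attainableI[of u "1 / \<delta>"]) simp_all
qed

lemma attainable_zero_iff: "attainable u 0 \<longleftrightarrow> achievable u 0"
  unfolding attainable_iff_achievable by (auto intro: exI[of _ 1])

text \<open>
  In \<open>D4\<close> the length of the answer may vary with \<open>q\<close>. Mixing an answer \<open>\<delta> x\<close> with an answer \<open>0\<close>
  shortens it to the common length \<open>\<delta>0\<close>; for the converse, \<open>\<delta> / 2\<close> is a lower bound that is strict.
\<close>

lemma achievable_ray_iff:
  fixes u :: "'a::finite \<Rightarrow> 'b::finite \<Rightarrow> real ^ 'm::finite"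
  assumes zero: "achievable u 0"
  shows "(\<exists>\<delta>0>0. \<forall>q\<in>mixed. \<exists>p\<in>mixed. \<exists>\<delta>>\<delta>0. mixed_payoff u p q = \<delta> *\<^sub>R x)
    \<longleftrightarrow> (\<exists>\<delta>>0. achievable u (\<delta> *\<^sub>R x))" (is "?L \<longleftrightarrow> ?R")
proof
  assume ?L
  then obtain \<delta>0 where \<delta>0: "\<delta>0 > 0"
    "\<And>q. q \<in> mixed \<Longrightarrow> \<exists>p\<in>mixed. \<exists>\<delta>>\<delta>0. mixed_payoff u p q = \<delta> *\<^sub>R x" by blast
  have "achievable u (\<delta>0 *\<^sub>R x)"
    unfolding achievable_def
  proof
    fix q :: "real^'b" assume q: "q \<in> mixed"
    obtain p \<delta> where p: "p \<in> mixed" "\<delta> > \<delta>0" "mixed_payoff u p q = \<delta> *\<^sub>R x" using \<delta>0(2)[OF q] by blast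
    obtain p' where p': "p' \<in> mixed" "mixed_payoff u p' q = 0" using zero q unfolding achievable_def by blast
    have "(\<delta>0 / \<delta>) *\<^sub>R mixed_payoff u p q + (1 - \<delta>0 / \<delta>) *\<^sub>R mixed_payoff u p' q \<in> (\<lambda>p. mixed_payoff u p q) ` mixed"
      using p(1,2) p'(1) \<delta>0(1) by (intro convexD[OF convex_payoffs]) simp_all
    then show "\<exists>p\<in>mixed. mixed_payoff u p q = \<delta>0 *\<^sub>R x" using p(2,3) p'(2) \<delta>0(1) by auto
  qed
  with \<delta>0(1) show ?R by blast
next
  assume ?R
  then obtain \<delta> where \<delta>: "\<delta> > 0" "\<forall>q\<in>mixed. \<exists>p\<in>mixed. mixed_payoff u p q = \<delta> *\<^sub>R x"
    unfolding achievable_def by blast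
  have "\<delta> / 2 > 0" "\<delta> > \<delta> / 2" using \<delta>(1) by simp_all
  with \<delta>(2) show ?L by blast
qed

theorem corollary3:
  fixes u :: "'a::finite \<Rightarrow> 'b::finite \<Rightarrow> real ^ 'm::finite"
    and x :: "real ^ 'm"
  assumes u_bounded: "\<And>a b i. u a b $ i \<in> {-1..1}"
    and x_nonzero: "x \<noteq> 0"
  defines "D1 \<equiv> attainable u 0"
    and "D2 \<equiv> \<exists>\<delta>>0. attainable (shifted_game u (\<delta> *\<^sub>R x)) 0"
    and "D3 \<equiv> \<exists>\<delta>>0. \<forall>l. projected_value u l \<ge> \<delta> * (x \<bullet> l)"
    and "D4 \<equiv> \<exists>\<delta>0>0. \<forall>q\<in>mixed. \<exists>p\<in>mixed. \<exists>\<delta>>\<delta>0. mixed_payoff u p q = \<delta> *\<^sub>R x"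
  shows "(attainable u x \<longleftrightarrow> D1 \<and> D2) \<and>
         (attainable u x \<longleftrightarrow> D1 \<and> D3) \<and>
         (attainable u x \<longleftrightarrow> D1 \<and> D4)"
proof -
  have D1: "D1 \<longleftrightarrow> achievable u 0"
    by (simp add: D1_def attainable_zero_iff)
  have D2: "D2 \<longleftrightarrow> (\<exists>\<delta>>0. achievable u (\<delta> *\<^sub>R x))"
    by (simp add: D2_def attainable_zero_iff achievable_shifted_game)
  have D3: "D3 \<longleftrightarrow> (\<exists>\<delta>>0. achievable u (\<delta> *\<^sub>R x))"
    by (simp add: D3_def flip: projected_value_ge_iff_achievable) (simp add: inner_commute)
  have D4: "D1 \<Longrightarrow> D4 \<longleftrightarrow> (\<exists>\<delta>>0. achievable u (\<delta> *\<^sub>R x))"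
    unfolding D1 D4_def by (rule achievable_ray_iff)
  show ?thesis
    unfolding attainable_iff_achievable[of u x] using D1 D2 D3 D4 by blast
qed

end
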